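(* Let $a,b,p,q,x\in\mathbb{R}$ and let $0\le\alpha\le 1$. Let $f(z)=z+\sum_{n=2}^{\infty}a_nz^n$ belong to the class $\mathcal{M}_{\Sigma}(\alpha,x)$. Put $$D=\left[(1+\alpha)b-p(1+\alpha)^2\right]bx^2-qa(1+\alpha)^2 .$$ Then $$|a_2|\le \frac{|bx|\sqrt{|bx|}}{\sqrt{|D|}},\qquad |a_3|\le \frac{|bx|}{2+4\alpha}+\frac{b^2x^2}{(1+\alpha)^2},$$ and for every $\nu\in\mathbb{R}$ $$|a_3-\nu a_2^2|\le \begin{cases}\dfrac{|bx|}{2+4\alpha} & \text{if } |\nu-1|\le \dfrac{|D|}{b^2x^2(2+4\alpha)},\\[3mm] \dfrac{|bx|^3\,|\nu-1|}{|D|} & \text{if } |\nu-1|\ge \dfrac{|D|}{b^2x^2(2+4\alpha)}.\end{cases}$$ Each estimate is asserted whenever the denominators occurring in it (and in its condition) are nonzero.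
   Context: $\Delta=\{z\in\mathbb{C}:|z|<1\}$. $\Sigma$ is the class of bi-univalent functions: analytic functions $f(z)=z+\sum_{n\ge2}a_nz^n$ on $\Delta$ such that $f$ is univalent in $\Delta$ and its inverse $f^{-1}$ (defined near $0$, with expansion $f^{-1}(w)=w-a_2w^2+(2a_2^2-a_3)w^3-\cdots$) extends to a univalent analytic function on $\Delta$, still denoted $f^{-1}$. Subordination: $F\prec G$ means that there is an analytic function $\omega:\Delta\to\Delta$ with $\omega(0)=0$ and $F(z)=G(\omega(z))$ for $z\in\Delta$. For real $a,b,p,q,x$, the generating function of the Horadam polynomials is $$\Pi(x,z)=\frac{a+(b-ap)xz}{1-pxz-qz^2}=a+bxz+(pbx^2+qa)z^2+\cdots .$$ The class $\mathcal{M}_{\Sigma}(\alpha,x)$ (depending also on $a,b,p,q$) consists of all $f\in\Sigma$ such that, with $g=f^{-1}$, $$(1-\alpha)\frac{zf'(z)}{f(z)}+\alpha\left(1+\frac{zf''(z)}{f'(z)}\right)\prec \Pi(x,z)+1-a$$ and $$(1-\alpha)\frac{wg'(w)}{g(w)}+\alpha\left(1+\frac{wg''(w)}{g'(w)}\right)\prec \Pi(x,w)+1-a\qquad(z,w\in\Delta),$$ where the left-hand sides are given their limit value at the origin.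
   Formalization: The bound on |a_3| is stated only for bx ≠ 0; for bx = 0 it would claim a_3 = 0, which fails for α = 0, x = 0, a = 2, q = 1 and f(z) = z/(1 − z²/4), where a_3 = 1/4. *)

theory Defs
  imports "HOL-Complex_Analysis.Complex_Analysis"
begin

abbreviation unit_disc :: "complex set" ("\<Delta>") where
  "\<Delta> \<equiv> ball 0 1"

text \<open>\<open>g\<close> is the univalent extension to \<open>\<Delta>\<close> of the inverse of \<open>f\<close>, which a priori is only
  defined near \<open>0\<close>. By the identity theorem, \<open>g\<close> is uniquely determined on \<open>\<Delta>\<close> by \<open>f\<close>.\<close>

definition univalent_inverse_extension :: "(complex \<Rightarrow> complex) \<Rightarrow> (complex \<Rightarrow> complex) \<Rightarrow> bool" where
  "univalent_inverse_extension f g \<longleftrightarrow>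
     g holomorphic_on \<Delta> \<and> inj_on g \<Delta> \<and>
     eventually (\<lambda>w. g w = the_inv_into \<Delta> f w) (nhds 0)"

definition bi_univalent :: "(complex \<Rightarrow> complex) set" where
  "bi_univalent =
     {f. f holomorphic_on \<Delta> \<and> f 0 = 0 \<and> deriv f 0 = 1 \<and> inj_on f \<Delta> \<and>
         (\<exists>g. univalent_inverse_extension f g)}"

definition subordinate :: "(complex \<Rightarrow> complex) \<Rightarrow> (complex \<Rightarrow> complex) \<Rightarrow> bool" where
  "subordinate F G \<longleftrightarrow>
     (\<exists>\<omega>. \<omega> holomorphic_on \<Delta> \<and> \<omega> ` \<Delta> \<subseteq> \<Delta> \<and> \<omega> 0 = 0 \<and> (\<forall>z\<in>\<Delta>. F z = G (\<omega> z)))"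

text \<open>The generating function is a rational function of \<open>z\<close>; \<^const>\<open>remove_sings\<close> only fills in its
  value at a common zero of numerator and denominator. Its value at an actual pole (\<open>0\<close> by
  convention) is irrelevant below: the functions subordinated to it are analytic on \<open>\<Delta>\<close>,
  so \<open>\<omega>\<close> cannot attain a pole.\<close>

definition horadam_gen :: "real \<Rightarrow> real \<Rightarrow> real \<Rightarrow> real \<Rightarrow> real \<Rightarrow> complex \<Rightarrow> complex" where
  "horadam_gen a b p q x =
     remove_sings (\<lambda>z. (of_real a + of_real (b - a * p) * of_real x * z) /
                       (1 - of_real p * of_real x * z - of_real q * z\<^sup>2))"

text \<open>For univalent \<open>f\<close> with \<open>f 0 = 0\<close>, the only singularity in \<open>\<Delta>\<close> of the expression below
  is the removable one at \<open>0\<close>, where \<^const>\<open>remove_sings\<close> supplies the limit.\<close>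

definition starlike_convex_expr :: "real \<Rightarrow> (complex \<Rightarrow> complex) \<Rightarrow> complex \<Rightarrow> complex" where
  "starlike_convex_expr \<alpha> f =
     remove_sings (\<lambda>z. (1 - of_real \<alpha>) * (z * deriv f z / f z) +
                       of_real \<alpha> * (1 + z * deriv (deriv f) z / deriv f z))"

definition M_Sigma ::
  "real \<Rightarrow> real \<Rightarrow> real \<Rightarrow> real \<Rightarrow> real \<Rightarrow> real \<Rightarrow> (complex \<Rightarrow> complex) set" where
  "M_Sigma a b p q \<alpha> x =
     {f \<in> bi_univalent. \<exists>g. univalent_inverse_extension f g \<and>
        subordinate (starlike_convex_expr \<alpha> f) (\<lambda>z. horadam_gen a b p q x z + 1 - of_real a) \<and>
        subordinate (starlike_convex_expr \<alpha> g) (\<lambda>w. horadam_gen a b p q x w + 1 - of_real a)}"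

end

theory Submission
  imports Defs
begin

text \<open>Write \<open>B = b x\<close>, \<open>C = p b x\<^sup>2 + q a\<close>, and let \<open>u\<^sub>i\<close>, \<open>v\<^sub>i\<close> be the Taylor coefficients of the two
  Schwarz functions. Comparing coefficients in the subordinations for \<open>f\<close> and \<open>g = f\<inverse>\<close> gives
  \<open>(1 + \<alpha>) a\<^sub>2 = B u\<^sub>1 = - B v\<^sub>1\<close>,
  \<open>(2 + 4 \<alpha>) a\<^sub>3 - (1 + 3 \<alpha>) a\<^sub>2\<^sup>2 = B u\<^sub>2 + C u\<^sub>1\<^sup>2\<close> and
  \<open>(2 + 4 \<alpha>) (2 a\<^sub>2\<^sup>2 - a\<^sub>3) - (1 + 3 \<alpha>) a\<^sub>2\<^sup>2 = B v\<^sub>2 + C v\<^sub>1\<^sup>2\<close>.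
  The sum of the last two yields \<open>2 D a\<^sub>2\<^sup>2 = B\<^sup>3 (u\<^sub>2 + v\<^sub>2)\<close>, and their difference yields
  \<open>a\<^sub>3 - a\<^sub>2\<^sup>2 = B (u\<^sub>2 - v\<^sub>2) / (4 + 8 \<alpha>)\<close> since \<open>u\<^sub>1\<^sup>2 = v\<^sub>1\<^sup>2\<close>. Everything then follows from
  \<open>|u\<^sub>i|, |v\<^sub>i| \<le> 1\<close>, which is Cauchy's estimate on discs of radius \<open>r \<rightarrow> 1\<close>.\<close>

unbundle fps_syntax and no vec_syntax

section \<open>Low-order coefficients of products and compositions of power series\<close>

lemma fps_mult_nth_2: "(F * G) $ 2 = F $ 0 * G $ 2 + F $ 1 * G $ 1 + F $ 2 * G $ 0"
  by (simp add: fps_mult_nth numeral_2_eq_2)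

lemma fps_mult_nth_3:
  "(F * G) $ 3 = F $ 0 * G $ 3 + F $ 1 * G $ 2 + F $ 2 * G $ 1 + F $ 3 * G $ 0"
  by (simp add: fps_mult_nth numeral_2_eq_2 numeral_3_eq_3)

lemma fps_compose_low_coeffs:
  fixes F G :: "'a :: comm_ring_1 fps"
  assumes "G $ 0 = 0"
  shows "(F oo G) $ 1 = F $ 1 * G $ 1"
    and "(F oo G) $ 2 = F $ 1 * G $ 2 + F $ 2 * (G $ 1)\<^sup>2"
    and "(F oo G) $ 3 = F $ 1 * G $ 3 + 2 * F $ 2 * G $ 1 * G $ 2 + F $ 3 * (G $ 1) ^ 3"
proof -
  have sums: "(\<Sum>i=0..1. h i) = h 0 + h 1" "(\<Sum>i=0..2. h i) = h 0 + h 1 + h 2"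
    "(\<Sum>i=0..3. h i) = h 0 + h 1 + h 2 + h 3" for h :: "nat \<Rightarrow> 'a"
    by (simp_all add: numeral_2_eq_2 numeral_3_eq_3)
  have pow: "G ^ 2 = G * G" "G ^ 3 = G * (G * G)"
    by (simp_all add: power2_eq_square power3_eq_cube mult.assoc)
  show "(F oo G) $ 1 = F $ 1 * G $ 1"
    by (simp add: fps_compose_nth sums(1))
  show "(F oo G) $ 2 = F $ 1 * G $ 2 + F $ 2 * (G $ 1)\<^sup>2"
    by (simp add: fps_compose_nth sums(2) pow fps_mult_nth_2 assms power2_eq_square)
  show "(F oo G) $ 3 = F $ 1 * G $ 3 + 2 * F $ 2 * G $ 1 * G $ 2 + F $ 3 * (G $ 1) ^ 3"
    by (simp add: fps_compose_nth sums(3) pow fps_mult_nth_2 fps_mult_nth_3 assms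
        power3_eq_cube algebra_simps)
qed

lemma has_fps_expansion_eventually_eq:
  assumes "f has_fps_expansion F" "eventually (\<lambda>z. f z = g z) (nhds 0)"
  shows "g has_fps_expansion F"
  using assms has_fps_expansion_cong by blast

section \<open>Schwarz functions and subordination\<close>

text \<open>Nothing is known about \<open>\<omega>\<close> on the unit circle, so Cauchy's estimate
  is applied on radius \<open>r < 1\<close>, where it gives
  \<open>norm (W $ n) * r ^ n \<le> 1\<close>; letting \<open>r\<close> tend to 1 from the left
  removes the factor.\<close>

lemma norm_fps_nth_disc_self_map_le_1:
  assumes holo: "\<omega> holomorphic_on \<Delta>" and maps: "\<omega> ` \<Delta> \<subseteq> \<Delta>"
    and W: "\<omega> has_fps_expansion W"
  shows "norm (W $ n) \<le> 1"
proof -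
  have bound: "norm (W $ n) * r ^ n \<le> 1" if r: "0 < r" "r < 1" for r
  proof -
    have sub: "cball 0 r \<subseteq> \<Delta>"
      using r by auto
    have "norm ((deriv ^^ n) \<omega> 0) \<le> fact n * 1 / r ^ n"
    proof (rule Cauchy_inequality)
      show "\<omega> holomorphic_on ball 0 r"
        using holo r by (rule_tac holomorphic_on_subset) auto
      show "continuous_on (cball 0 r) \<omega>"
        using holomorphic_on_imp_continuous_on[OF holo] sub continuous_on_subset by blast
      show "norm (\<omega> z) \<le> 1" if "norm (0 - z) = r" for z
        using maps that r by (force simp: image_subset_iff)
    qed (use r in auto)
    moreover have "W $ n = (deriv ^^ n) \<omega> 0 / fact n"
      by (rule fps_nth_fps_expansion[OF W])
    then have "norm ((deriv ^^ n) \<omega> 0) = fact n * norm (W $ n)"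
      by (simp add: norm_divide)
    ultimately show ?thesis
      using r by (simp add: field_simps)
  qed
  have "((\<lambda>r. norm (W $ n) * r ^ n) \<longlongrightarrow> norm (W $ n) * 1 ^ n) (at_left 1)"
    by (intro tendsto_intros)
  moreover have "eventually (\<lambda>r. norm (W $ n) * r ^ n \<le> 1) (at_left (1 :: real))"
    using eventually_at_left_real[OF zero_less_one] by eventually_elim (auto intro: bound)
  ultimately show ?thesis
    using tendsto_upperbound[of _ _ "at_left (1 :: real)" 1] by simp
qed

text \<open>The Schwarz function enters only through its first two coefficients \<open>u\<close> and
  \<open>v\<close>. Its composition with \<open>G\<close> also provides the expansion of
  \<open>F\<close>, so analyticity of \<open>F\<close> at 0 is a consequence of the
  subordination.\<close>

lemma subordinate_fps_expansion:
  assumes "subordinate F G" "G has_fps_expansion H"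
  obtains K u v where "F has_fps_expansion K" "norm u \<le> 1" "norm v \<le> 1"
    "K $ 0 = H $ 0" "K $ 1 = H $ 1 * u" "K $ 2 = H $ 1 * v + H $ 2 * u\<^sup>2"
proof -
  obtain \<omega> where \<omega>: "\<omega> holomorphic_on \<Delta>" "\<omega> ` \<Delta> \<subseteq> \<Delta>" "\<omega> 0 = 0" "\<And>z. z \<in> \<Delta> \<Longrightarrow> F z = G (\<omega> z)"
    using assms(1) by (auto simp: subordinate_def)
  define W where "W = fps_expansion \<omega> 0"
  have W: "\<omega> has_fps_expansion W"
    unfolding W_def using \<omega>(1) by (intro has_fps_expansion_fps_expansion[of \<Delta>]) auto
  have W0: "W $ 0 = 0"
    using has_fps_expansion_imp_0_eq_fps_nth_0[OF W] \<omega>(3) by simp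
  have "(G \<circ> \<omega>) has_fps_expansion (H oo W)"
    by (rule has_fps_expansion_compose[OF assms(2) W W0])
  moreover have "eventually (\<lambda>z. (G \<circ> \<omega>) z = F z) (nhds 0)"
    using eventually_nhds_in_open[of \<Delta> 0] by (auto elim!: eventually_mono simp: \<omega>(4))
  ultimately have "F has_fps_expansion (H oo W)"
    using has_fps_expansion_eventually_eq by blast
  then show thesis
    using norm_fps_nth_disc_self_map_le_1[OF \<omega>(1,2) W] W0
    by (intro that[of "H oo W" "W $ 1" "W $ 2"]) (simp_all only: fps_compose_low_coeffs fps_compose_nth_0)
qed

section \<open>Taylor coefficients of the Horadam generating function\<close>

lemma horadam_gen_fps_expansion:
  obtains H where "horadam_gen a b p q x has_fps_expansion H"
    "H $ 0 = of_real a" "H $ 1 = of_real (b * x)" "H $ 2 = of_real (p * b * x\<^sup>2 + q * a)"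
proof -
  define N :: "complex fps" where
    "N = fps_const (of_real a) + fps_const (of_real (b - a * p) * of_real x) * fps_X"
  define M :: "complex fps" where
    "M = 1 - fps_const (of_real p * of_real x) * fps_X - fps_const (of_real q) * fps_X ^ 2"
  define Q where "Q = N / M"
  define h where "h = (\<lambda>z. (of_real a + of_real (b - a * p) * of_real x * z) /
                       (1 - of_real p * of_real x * z - of_real q * z\<^sup>2 :: complex))"
  have M0: "M $ 0 = 1"
    by (simp add: M_def)
  have "(\<lambda>z. of_real a + of_real (b - a * p) * of_real x * z) has_fps_expansion N"
    unfolding N_def by (intro fps_expansion_intros)
  moreover have "(\<lambda>z. 1 - of_real p * of_real x * z - of_real q * z\<^sup>2) has_fps_expansion M"
    unfolding M_def by (intro fps_expansion_intros)
  ultimately have h: "h has_fps_expansion Q"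
    unfolding h_def Q_def using M0 by (intro has_fps_expansion_divide') auto
  \<comment> \<open>The denominator is 1 at 0, so \<open>h\<close> is already analytic there and
    \<open>remove_sings\<close> changes nothing near 0.\<close>
  have "h analytic_on {0}"
    using has_fps_expansion_imp_analytic_0[OF h] .
  then have "eventually (\<lambda>z. h z = horadam_gen a b p q x z) (nhds 0)"
    unfolding horadam_gen_def h_def[symmetric]
    by (auto dest!: eventually_remove_sings_eq_nhds elim: eventually_mono)
  with h have exp: "horadam_gen a b p q x has_fps_expansion Q"
    using has_fps_expansion_eventually_eq by blast
  \<comment> \<open>Clearing the denominator turns the quotient into a recurrence that yields the
    coefficients of \<open>Q\<close> one after another.\<close>
  have MN: "N = Q * M"
    unfolding Q_def using M0 by (simp add: fps_divide_unit inverse_mult_eq_1 mult.assoc)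
  have Mn: "M $ Suc 0 = - of_real (p * x)" "M $ 2 = - of_real q"
    by (simp_all add: M_def)
  have Nn: "N $ 0 = of_real a" "N $ Suc 0 = of_real ((b - a * p) * x)" "N $ 2 = 0"
    by (simp_all add: N_def)
  have c0: "Q $ 0 = of_real a"
    using arg_cong[OF MN, of "\<lambda>F. F $ 0"] by (simp add: M0 Nn)
  have c1: "Q $ 1 = of_real (b * x)"
    using arg_cong[OF MN, of "\<lambda>F. F $ 1"] c0 by (simp add: M0 Nn Mn algebra_simps)
  have c2: "Q $ 2 = of_real (p * b * x\<^sup>2 + q * a)"
    using arg_cong[OF MN, of "\<lambda>F. F $ 2"] c0 c1
    by (simp add: fps_mult_nth_2 M0 Nn Mn algebra_simps power2_eq_square)
  show thesis
    using that[OF exp c0 c1 c2] .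
qed

section \<open>Taylor coefficients of the starlike-convex expression\<close>

lemma starlike_convex_expr_coeffs:
  assumes F: "f has_fps_expansion F" "F $ 0 = 0" "F $ 1 = 1"
    and K: "starlike_convex_expr \<alpha> f has_fps_expansion K"
  shows "K $ 1 = (1 + of_real \<alpha>) * F $ 2"
    and "K $ 2 = (2 + 4 * of_real \<alpha>) * F $ 3 - (1 + 3 * of_real \<alpha>) * (F $ 2)\<^sup>2"
proof -
  have F': "deriv f has_fps_expansion fps_deriv F"
    and F'': "deriv (deriv f) has_fps_expansion fps_deriv (fps_deriv F)"
    using F(1) by (auto intro: has_fps_expansion_deriv)
  define E where "E = (\<lambda>z. (1 - of_real \<alpha>) * (z * deriv f z / f z) +
                       of_real \<alpha> * (1 + z * deriv (deriv f) z / deriv f z))"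
  have "(deriv f \<longlongrightarrow> 1) (nhds 0)"
    using has_fps_expansion_imp_tendsto_0[OF F'] F(3) by simp
  then have "eventually (\<lambda>z. deriv f z \<noteq> 0) (nhds 0)"
    by (rule tendsto_imp_eventually_ne) simp
  then have nz': "eventually (\<lambda>z. deriv f z \<noteq> 0) (at 0)"
    by (simp add: eventually_nhds_conv_at)
  have ana0: "f analytic_on {0}"
    using has_fps_expansion_imp_analytic_0[OF F(1)] .
  have f0: "f 0 = 0"
    using has_fps_expansion_imp_0_eq_fps_nth_0[OF F(1)] F(2) by simp
  have "deriv f 0 = 1"
    using fps_nth_fps_expansion[OF F(1), of 1] F(3) by simp
  then have "(f has_field_derivative 1) (at 0)"
    using analytic_on_imp_differentiable_at[OF ana0]
    by (simp add: DERIV_deriv_iff_field_differentiable[symmetric])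
  then have "(\<lambda>z. f z / z) \<midarrow>0\<rightarrow> 1"
    by (simp add: has_field_derivative_iff f0)
  then have "eventually (\<lambda>z. f z / z \<noteq> 0) (at 0)"
    by (rule tendsto_imp_eventually_ne) simp
  then have nz: "eventually (\<lambda>z. f z \<noteq> 0) (at 0)"
    by eventually_elim auto
  have ana: "eventually (\<lambda>z. f analytic_on {z}) (at 0)"
    using isolated_singularity_at_analytic[OF ana0] by (simp add: isolated_singularity_at_altdef)
  \<comment> \<open>Multiplying by \<open>f f'\<close> turns the quotients into an identity of power series that also holds
    at \<open>0\<close>, so no division of series with vanishing constant term is needed.\<close>
  have "eventually (\<lambda>z. starlike_convex_expr \<alpha> f z * f z * deriv f z =
      (1 - of_real \<alpha>) * (z * (deriv f z * deriv f z)) +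
      of_real \<alpha> * (f z * (deriv f z + z * deriv (deriv f) z))) (at 0)"
    using ana nz nz'
  proof eventually_elim
    case (elim z)
    have "E analytic_on {z}"
      unfolding E_def using elim by (intro analytic_intros) auto
    then have "starlike_convex_expr \<alpha> f z = E z"
      unfolding starlike_convex_expr_def E_def[symmetric] by simp
    then show ?case
      using elim by (simp add: E_def field_simps)
  qed
  then have "eventually (\<lambda>z. starlike_convex_expr \<alpha> f z * f z * deriv f z =
      (1 - of_real \<alpha>) * (z * (deriv f z * deriv f z)) +
      of_real \<alpha> * (f z * (deriv f z + z * deriv (deriv f) z))) (nhds 0)"
    \<comment> \<open>At 0 both sides vanish, because \<open>f 0 = 0\<close> and the remaining term
      carries a factor \<open>z\<close>.\<close>
    by (simp add: eventually_nhds_conv_at f0)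
  moreover have "(\<lambda>z. starlike_convex_expr \<alpha> f z * f z * deriv f z) has_fps_expansion
      K * F * fps_deriv F"
    by (intro fps_expansion_intros K F F')
  ultimately have "(\<lambda>z. (1 - of_real \<alpha>) * (z * (deriv f z * deriv f z)) +
      of_real \<alpha> * (f z * (deriv f z + z * deriv (deriv f) z))) has_fps_expansion
      K * F * fps_deriv F"
    by (rule has_fps_expansion_eventually_eq[rotated])
  moreover have "(\<lambda>z. (1 - of_real \<alpha>) * (z * (deriv f z * deriv f z)) +
      of_real \<alpha> * (f z * (deriv f z + z * deriv (deriv f) z))) has_fps_expansion
      fps_const (1 - of_real \<alpha>) * (fps_X * (fps_deriv F * fps_deriv F)) +
      fps_const (of_real \<alpha>) * (F * (fps_deriv F + fps_X * fps_deriv (fps_deriv F)))"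
    by (intro fps_expansion_intros F F' F'')
  ultimately have eq: "K * F * fps_deriv F =
      fps_const (1 - of_real \<alpha>) * (fps_X * (fps_deriv F * fps_deriv F)) +
      fps_const (of_real \<alpha>) * (F * (fps_deriv F + fps_X * fps_deriv (fps_deriv F)))"
    by (rule fps_expansion_unique_complex)
  have F1: "F $ Suc 0 = 1"
    using F(3) by simp
  note simps = fps_mult_nth_2 fps_mult_nth_3 F(2) F1 numeral_2_eq_2[symmetric]
    numeral_3_eq_3[symmetric]
  \<comment> \<open>\<open>F\<close> begins in degree 1, so the coefficient of index
    \<open>n + 1\<close> in \<open>eq\<close> determines \<open>K $ n\<close>; indices 1, 2 and 3
    are therefore the ones compared.\<close>
  have "K $ 0 = 1"
    using arg_cong[OF eq, of "\<lambda>A. A $ 1"] by (simp add: simps)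
  then show K1: "K $ 1 = (1 + of_real \<alpha>) * F $ 2"
    using arg_cong[OF eq, of "\<lambda>A. A $ 2"] \<open>K $ 0 = 1\<close>
    by (simp add: simps algebra_simps power2_eq_square)
  show "K $ 2 = (2 + 4 * of_real \<alpha>) * F $ 3 - (1 + 3 * of_real \<alpha>) * (F $ 2)\<^sup>2"
    using arg_cong[OF eq, of "\<lambda>A. A $ 3"] K1 \<open>K $ 0 = 1\<close>
    by (simp add: simps algebra_simps power2_eq_square)
qed

section \<open>Taylor coefficients of the inverse function\<close>

text \<open>Near 0 one has \<open>g (f z) = z\<close>, hence \<open>G oo F = fps_X\<close>. This is
  a triangular system for the coefficients of \<open>G\<close>, solved up to degree 3.\<close>

lemma univalent_inverse_extension_fps_expansion:
  assumes inj: "inj_on f \<Delta>" and inv: "univalent_inverse_extension f g"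
    and F: "f has_fps_expansion F" "F $ 0 = 0" "F $ 1 = 1"
  obtains G where "g has_fps_expansion G" "G $ 0 = 0" "G $ 1 = 1"
    "G $ 2 = - (F $ 2)" "G $ 3 = 2 * (F $ 2)\<^sup>2 - F $ 3"
proof -
  define G where "G = fps_expansion g 0"
  have G: "g has_fps_expansion G"
    unfolding G_def using inv
    by (intro has_fps_expansion_fps_expansion[of \<Delta>]) (auto simp: univalent_inverse_extension_def)
  \<comment> \<open>Since \<open>f\<close> tends to 0, the identity for \<open>g\<close> near 0 can
    be evaluated at \<open>f z\<close>, where \<open>the_inv_into\<close> returns \<open>z\<close>
    by injectivity.\<close>
  have "(f \<longlongrightarrow> 0) (nhds 0)"
    using has_fps_expansion_imp_tendsto_0[OF F(1)] F(2) by simp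
  moreover have "eventually (\<lambda>w. g w = the_inv_into \<Delta> f w) (nhds 0)"
    using inv by (simp add: univalent_inverse_extension_def)
  ultimately have "eventually (\<lambda>z. g (f z) = the_inv_into \<Delta> f (f z)) (nhds 0)"
    by (rule eventually_compose_filterlim[rotated])
  moreover have "eventually (\<lambda>z. z \<in> \<Delta>) (nhds 0)"
    by (rule eventually_nhds_in_open) auto
  ultimately have "eventually (\<lambda>z. (g \<circ> f) z = z) (nhds 0)"
    by eventually_elim (simp add: the_inv_into_f_f[OF inj])
  moreover have "(g \<circ> f) has_fps_expansion (G oo F)"
    by (rule has_fps_expansion_compose[OF G F(1,2)])
  ultimately have "(\<lambda>z. z) has_fps_expansion (G oo F)"
    by (rule has_fps_expansion_eventually_eq[rotated])
  then have eq: "G oo F = fps_X"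
    using has_fps_expansion_fps_X by (rule fps_expansion_unique_complex)
  note coeffs = fps_compose_low_coeffs[OF F(2), of G, unfolded eq F(3)]
  have G0: "G $ 0 = 0"
    using arg_cong[OF eq, of "\<lambda>A. A $ 0"] by simp
  have G1: "G $ 1 = 1"
    using coeffs(1) by simp
  have "F $ 2 + G $ 2 = 0"
    using coeffs(2) G1 by simp
  then have G2: "G $ 2 = - (F $ 2)"
    by (simp only: add_eq_0_iff)
  have "F $ 3 + 2 * G $ 2 * F $ 2 + G $ 3 = 0"
    using coeffs(3) G1 by simp
  then have "G $ 3 = 2 * (F $ 2)\<^sup>2 - F $ 3"
    unfolding G2 by (simp add: power2_eq_square algebra_simps)
  with G G0 G1 G2 show thesis
    by (rule that)
qed

section \<open>Two elementary inequalities behind the case distinction in \<nu>\<close>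

text \<open>Collecting the terms in \<open>u\<close> and in \<open>v\<close> gives the bound |h + k|
  + |h - k|, which equals twice the larger of |h| and |k|. The two entries of this maximum become
  the two cases of the estimate for \<open>c 3 - of_real \<nu> * (c 2)\<^sup>2\<close>.\<close>

lemma norm_add_times_diff_times_le:
  fixes u v :: complex and h k :: real
  assumes "norm u \<le> 1" "norm v \<le> 1"
  shows "norm (of_real h * (u + v) + of_real k * (u - v)) \<le> 2 * max \<bar>h\<bar> \<bar>k\<bar>"
proof -
  have "of_real h * (u + v) + of_real k * (u - v) = of_real (h + k) * u + of_real (h - k) * v"
    by (simp add: algebra_simps)
  also have "norm \<dots> \<le> norm (of_real (h + k) * u) + norm (of_real (h - k) * v)"
    by (rule norm_triangle_ineq)
  also have "\<dots> = \<bar>h + k\<bar> * norm u + \<bar>h - k\<bar> * norm v"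
    by (simp only: norm_mult norm_of_real)
  also have "\<dots> \<le> \<bar>h + k\<bar> * 1 + \<bar>h - k\<bar> * 1"
    using assms by (intro add_mono mult_left_mono) auto
  also have "\<dots> \<le> 2 * max \<bar>h\<bar> \<bar>k\<bar>"
    by (auto simp: max_def abs_if)
  finally show ?thesis .
qed

text \<open>The two competing bounds \<open>r ^ 3 * y / d\<close> and \<open>r / t\<close> have the
  common positive factor \<open>r ^ 3 / d\<close>; cancelling it leaves a comparison of
  \<open>y\<close> with the crossing point. It is applied with \<open>r = \<bar>B\<bar>\<close>,
  \<open>t = 2 + 4 * \<alpha>\<close>, \<open>d = \<bar>D\<bar>\<close> and
  \<open>y = \<bar>\<nu> - 1\<bar>\<close>.\<close>

lemma threshold_iff:
  fixes d r t y :: real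
  assumes "r > 0" "t > 0" "d > 0"
  shows "r ^ 3 * y / d \<le> r / t \<longleftrightarrow> y \<le> d / (r\<^sup>2 * t)"
    and "r / t \<le> r ^ 3 * y / d \<longleftrightarrow> d / (r\<^sup>2 * t) \<le> y"
proof -
  have eq: "r ^ 3 * y / d = r ^ 3 / d * y" "r / t = r ^ 3 / d * (d / (r\<^sup>2 * t))"
    using assms by (simp_all add: power2_eq_square power3_eq_cube)
  have "r ^ 3 / d > 0"
    using assms by simp
  then show "r ^ 3 * y / d \<le> r / t \<longleftrightarrow> y \<le> d / (r\<^sup>2 * t)"
    and "r / t \<le> r ^ 3 * y / d \<longleftrightarrow> d / (r\<^sup>2 * t) \<le> y"
    unfolding eq by (simp_all only: mult_le_cancel_left_pos)
qed

section \<open>Bounds for the second and third coefficients and the Fekete-Szego functional\<close>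

theorem theorem2p2:
  fixes a b p q x \<alpha> D :: real
    and f :: "complex \<Rightarrow> complex"
    and c :: "nat \<Rightarrow> complex"
  assumes \<alpha>: "0 \<le> \<alpha>" "\<alpha> \<le> 1"
    and f: "f \<in> M_Sigma a b p q \<alpha> x"
    and c: "\<And>z. z \<in> \<Delta> \<Longrightarrow> (\<lambda>n. c (n + 2) * z ^ (n + 2)) sums (f z - z)"
    and D: "D = ((1 + \<alpha>) * b - p * (1 + \<alpha>)\<^sup>2) * b * x\<^sup>2 - q * a * (1 + \<alpha>)\<^sup>2"
  shows "(D \<noteq> 0 \<longrightarrow> norm (c 2) \<le> \<bar>b * x\<bar> * sqrt \<bar>b * x\<bar> / sqrt \<bar>D\<bar>) \<and>
    (b * x \<noteq> 0 \<longrightarrow> norm (c 3) \<le> \<bar>b * x\<bar> / (2 + 4 * \<alpha>) + b\<^sup>2 * x\<^sup>2 / (1 + \<alpha>)\<^sup>2) \<and>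
    (\<forall>\<nu>::real. b * x \<noteq> 0 \<longrightarrow>
       (\<bar>\<nu> - 1\<bar> \<le> \<bar>D\<bar> / (b\<^sup>2 * x\<^sup>2 * (2 + 4 * \<alpha>)) \<longrightarrow>
          norm (c 3 - of_real \<nu> * (c 2)\<^sup>2) \<le> \<bar>b * x\<bar> / (2 + 4 * \<alpha>)) \<and>
       (D \<noteq> 0 \<and> \<bar>\<nu> - 1\<bar> \<ge> \<bar>D\<bar> / (b\<^sup>2 * x\<^sup>2 * (2 + 4 * \<alpha>)) \<longrightarrow>
          norm (c 3 - of_real \<nu> * (c 2)\<^sup>2) \<le> \<bar>b * x\<bar> ^ 3 * \<bar>\<nu> - 1\<bar> / \<bar>D\<bar>))"
proof -
  obtain g where bi: "f holomorphic_on \<Delta>" "f 0 = 0" "deriv f 0 = 1" "inj_on f \<Delta>"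
    and g: "univalent_inverse_extension f g"
    and subf: "subordinate (starlike_convex_expr \<alpha> f) (\<lambda>z. horadam_gen a b p q x z + 1 - of_real a)"
    and subg: "subordinate (starlike_convex_expr \<alpha> g) (\<lambda>w. horadam_gen a b p q x w + 1 - of_real a)"
    using f by (auto simp: M_Sigma_def bi_univalent_def)
  \<comment> \<open>The values \<open>c 0\<close> and \<open>c 1\<close> are unconstrained, so the
    normalisation of \<open>f\<close> is written in explicitly.\<close>
  define F where "F = Abs_fps (\<lambda>n. if n = 0 then 0 else if n = 1 then 1 else c n)"
  have Fn: "F $ 0 = 0" "F $ 1 = 1" "F $ 2 = c 2" "F $ 3 = c 3"
    by (simp_all add: F_def)
  have "(\<lambda>n. F $ n * z ^ n) sums f z" if "z \<in> \<Delta>" for z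
  proof -
    have "(\<lambda>n. F $ (n + 2) * z ^ (n + 2)) sums (f z - z)"
      using c[OF that] by (simp add: F_def)
    then show ?thesis
      by (subst (asm) sums_iff_shift) (simp add: numeral_2_eq_2 F_def)
  qed
  then have F: "f has_fps_expansion F"
    using eventually_nhds_in_open[of \<Delta> 0]
    by (intro has_fps_expansionI) (auto elim!: eventually_mono)
  obtain G where G: "g has_fps_expansion G" "G $ 0 = 0" "G $ 1 = 1"
    "G $ 2 = - c 2" "G $ 3 = 2 * (c 2)\<^sup>2 - c 3"
    by (rule univalent_inverse_extension_fps_expansion[OF bi(4) g F Fn(1,2), unfolded Fn])
  obtain H0 where H0: "horadam_gen a b p q x has_fps_expansion H0"
    "H0 $ 0 = of_real a" "H0 $ 1 = of_real (b * x)" "H0 $ 2 = of_real (p * b * x\<^sup>2 + q * a)"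
    by (rule horadam_gen_fps_expansion)
  \<comment> \<open>The shift by \<open>1 - a\<close> affects only the constant term; the
    coefficients of index 1 and 2 remain those of the generating function.\<close>
  define H where "H = H0 + 1 - fps_const (of_real a)"
  have H: "(\<lambda>z. horadam_gen a b p q x z + 1 - of_real a) has_fps_expansion H"
    unfolding H_def by (intro fps_expansion_intros H0)
  define B where "B = b * x"
  define C where "C = p * b * x\<^sup>2 + q * a"
  define s :: complex where "s = of_real \<alpha>"
  have Hn: "H $ 1 = of_real B" "H $ 2 = of_real C"
    using H0 by (simp_all add: H_def B_def C_def)
  obtain K u1 u2 where K: "starlike_convex_expr \<alpha> f has_fps_expansion K"
    and u: "norm u1 \<le> 1" "norm u2 \<le> 1"
    "K $ 1 = of_real B * u1" "K $ 2 = of_real B * u2 + of_real C * u1\<^sup>2"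
    by (rule subordinate_fps_expansion[OF subf H, unfolded Hn])
  obtain L v1 v2 where L: "starlike_convex_expr \<alpha> g has_fps_expansion L"
    and v: "norm v1 \<le> 1" "norm v2 \<le> 1"
    "L $ 1 = of_real B * v1" "L $ 2 = of_real B * v2 + of_real C * v1\<^sup>2"
    by (rule subordinate_fps_expansion[OF subg H, unfolded Hn])

  \<comment> \<open>Coefficient equations and their elimination\<close>
  have e1: "(1 + s) * c 2 = of_real B * u1"
    using starlike_convex_expr_coeffs(1)[OF F Fn(1,2) K] u(3) by (simp add: Fn s_def)
  have e2: "(2 + 4 * s) * c 3 - (1 + 3 * s) * (c 2)\<^sup>2 = of_real B * u2 + of_real C * u1\<^sup>2"
    using starlike_convex_expr_coeffs(2)[OF F Fn(1,2) K] u(4) by (simp add: Fn s_def)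
  have e3: "- ((1 + s) * c 2) = of_real B * v1"
    using starlike_convex_expr_coeffs(1)[OF G(1-3) L] v(3) by (simp add: G s_def)
  have e4: "(2 + 4 * s) * (2 * (c 2)\<^sup>2 - c 3) - (1 + 3 * s) * (c 2)\<^sup>2 =
      of_real B * v2 + of_real C * v1\<^sup>2"
    using starlike_convex_expr_coeffs(2)[OF G(1-3) L] v(4) by (simp add: G s_def)
  have pos: "1 + \<alpha> > 0" "2 + 4 * \<alpha> > 0"
    using \<alpha> by auto
  have s_eq: "1 + s = of_real (1 + \<alpha>)" "4 + 8 * s = of_real (4 + 8 * \<alpha>)"
    by (simp_all add: s_def)
  have s0: "1 + s \<noteq> 0" "4 + 8 * s \<noteq> 0"
    using pos unfolding s_eq of_real_eq_0_iff by auto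
  have D': "D = (1 + \<alpha>) * B\<^sup>2 - C * (1 + \<alpha>)\<^sup>2"
    unfolding D B_def C_def by (simp add: power2_eq_square algebra_simps)
  have Dc: "of_real D = (1 + s) * of_real B ^ 2 - of_real C * (1 + s)\<^sup>2"
    unfolding D' s_def by simp
  have a2: "2 * of_real D * (c 2)\<^sup>2 = of_real B ^ 3 * (u2 + v2)"
  proof -
    \<comment> \<open>The sum of \<open>e2\<close> and \<open>e4\<close>, followed by the sum of the
      squares of \<open>e1\<close> and \<open>e3\<close>. Multiplying the first by
      \<open>B ^ 2\<close> and the second by \<open>C\<close> eliminates
      \<open>u1\<^sup>2 + v1\<^sup>2\<close> without any division, so \<open>a2\<close> also covers
      \<open>B = 0\<close> and \<open>D = 0\<close>.\<close>
    have "2 * (1 + s) * (c 2)\<^sup>2 = of_real B * (u2 + v2) + of_real C * (u1\<^sup>2 + v1\<^sup>2)"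
      using e2 e4 by algebra
    moreover have "2 * (1 + s)\<^sup>2 * (c 2)\<^sup>2 = of_real B ^ 2 * (u1\<^sup>2 + v1\<^sup>2)"
      using e1 e3 by algebra
    ultimately show ?thesis
      unfolding Dc by algebra
  qed
  have c2: "norm (c 2) \<le> \<bar>B\<bar> / (1 + \<alpha>)"
  proof -
    have "(1 + \<alpha>) * norm (c 2) = \<bar>B\<bar> * norm u1"
      using arg_cong[OF e1, of norm] pos unfolding s_eq by (simp only: norm_mult norm_of_real abs_of_pos)
    also have "\<dots> \<le> \<bar>B\<bar>"
      using u(1) by (simp add: mult_left_le)
    finally show ?thesis
      using pos by (simp add: field_simps)
  qed
  have a3: "c 3 - (c 2)\<^sup>2 = of_real (B / (2 * (2 + 4 * \<alpha>))) * (u2 - v2)" if "B \<noteq> 0"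
  proof -
    \<comment> \<open>Cancelling \<open>B\<close> is legitimate because it is nonzero; the terms
      with \<open>C\<close> then drop out of the difference of \<open>e2\<close> and
      \<open>e4\<close>.\<close>
    have "v1 = - u1"
      using e1 e3 that by (metis mult_left_cancel mult_minus_right of_real_eq_0_iff)
    then have "(c 3 - (c 2)\<^sup>2) * (4 + 8 * s) = of_real B * (u2 - v2)"
      using e2 e4 by algebra
    then have "c 3 - (c 2)\<^sup>2 = of_real B * (u2 - v2) / (4 + 8 * s)"
      by (rule eq_divide_imp[OF s0(2)])
    then show ?thesis
      by (simp add: s_def)
  qed
  have uv: "norm (u2 + v2) \<le> 2"
    using u v norm_triangle_ineq[of u2 v2] by linarith

  \<comment> \<open>The Fekete-Szego functional\<close>
  have nu: "norm (c 3 - of_real \<nu> * (c 2)\<^sup>2) \<le>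
      2 * max \<bar>(1 - \<nu>) * B ^ 3 / (2 * D)\<bar> \<bar>B / (2 * (2 + 4 * \<alpha>))\<bar>"
    if "B \<noteq> 0" "D \<noteq> 0 \<or> \<nu> = 1" for \<nu>
  proof -
    \<comment> \<open>For \<open>\<nu> = 1\<close> both sides are 0 whatever \<open>D\<close> is;
      otherwise \<open>D\<close> is nonzero and \<open>a2\<close> can be solved for the square of
      \<open>c 2\<close>.\<close>
    have "of_real (1 - \<nu>) * (c 2)\<^sup>2 = of_real ((1 - \<nu>) * B ^ 3 / (2 * D)) * (u2 + v2)"
    proof (cases "\<nu> = 1")
      case False
      then have "of_real (2 * D) \<noteq> (0 :: complex)"
        using that(2) by simp
      moreover have "(c 2)\<^sup>2 * of_real (2 * D) = of_real B ^ 3 * (u2 + v2)"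
        using a2 by (simp add: mult_ac)
      ultimately have "(c 2)\<^sup>2 = of_real B ^ 3 * (u2 + v2) / of_real (2 * D)"
        by (rule eq_divide_imp)
      then show ?thesis
        by simp
    qed simp
    moreover have "c 3 - of_real \<nu> * (c 2)\<^sup>2 = of_real (1 - \<nu>) * (c 2)\<^sup>2 + (c 3 - (c 2)\<^sup>2)"
      by (simp add: algebra_simps)
    ultimately have "c 3 - of_real \<nu> * (c 2)\<^sup>2 = of_real ((1 - \<nu>) * B ^ 3 / (2 * D)) * (u2 + v2) +
        of_real (B / (2 * (2 + 4 * \<alpha>))) * (u2 - v2)"
      using a3[OF that(1)] by simp
    then show ?thesis
      using norm_add_times_diff_times_le[OF u(2) v(2)] by (simp only:)
  qed
  have max_eq: "2 * max \<bar>(1 - \<nu>) * B ^ 3 / (2 * D)\<bar> \<bar>B / (2 * (2 + 4 * \<alpha>))\<bar> =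
      max (\<bar>B\<bar> ^ 3 * \<bar>\<nu> - 1\<bar> / \<bar>D\<bar>) (\<bar>B\<bar> / (2 + 4 * \<alpha>))" for \<nu>
  proof -
    have "2 * max y z = max (2 * y) (2 * z)" for y z :: real
      by (simp add: max_def)
    moreover have "2 * \<bar>(1 - \<nu>) * B ^ 3 / (2 * D)\<bar> = \<bar>B\<bar> ^ 3 * \<bar>\<nu> - 1\<bar> / \<bar>D\<bar>"
      by (simp add: abs_mult power_abs abs_minus_commute)
    moreover have "2 * \<bar>B / (2 * (2 + 4 * \<alpha>))\<bar> = \<bar>B\<bar> / (2 + 4 * \<alpha>)"
      using pos by (simp add: field_simps)
    ultimately show ?thesis
      by simp
  qed
  note nu = nu[unfolded max_eq]
  have bx2: "b\<^sup>2 * x\<^sup>2 = \<bar>B\<bar>\<^sup>2"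
    by (simp add: B_def power_mult_distrib)

  \<comment> \<open>The individual estimates\<close>
  have a2_bound: "norm (c 2) \<le> \<bar>B\<bar> * sqrt \<bar>B\<bar> / sqrt \<bar>D\<bar>" if "D \<noteq> 0"
  proof -
    have "2 * \<bar>D\<bar> * (norm (c 2))\<^sup>2 = \<bar>B\<bar> ^ 3 * norm (u2 + v2)"
      using arg_cong[OF a2, of norm] by (simp add: norm_mult norm_power)
    also have "\<dots> \<le> \<bar>B\<bar> ^ 3 * 2"
      using uv by (intro mult_left_mono) auto
    finally have "(norm (c 2))\<^sup>2 \<le> (\<bar>B\<bar> * sqrt \<bar>B\<bar> / sqrt \<bar>D\<bar>)\<^sup>2"
      using that by (simp add: power_mult_distrib power_divide pos_le_divide_eq power2_eq_square power3_eq_cube mult_ac)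
    then show ?thesis
      by (rule power2_le_imp_le) simp
  qed
  have a3_bound: "norm (c 3) \<le> \<bar>B\<bar> / (2 + 4 * \<alpha>) + \<bar>B\<bar>\<^sup>2 / (1 + \<alpha>)\<^sup>2" if "B \<noteq> 0"
  proof -
    \<comment> \<open>The first summand is the case \<open>\<nu> = 1\<close> of \<open>nu\<close>,
      available even when \<open>D = 0\<close>; the second is bounded by \<open>c2\<close>, which
      comes from \<open>e1\<close> and does not involve \<open>D\<close>.\<close>
    have "norm (c 3) \<le> norm (c 3 - (c 2)\<^sup>2) + norm ((c 2)\<^sup>2)"
      using norm_triangle_ineq[of "c 3 - (c 2)\<^sup>2" "(c 2)\<^sup>2"] by simp
    also have "norm (c 3 - (c 2)\<^sup>2) \<le> \<bar>B\<bar> / (2 + 4 * \<alpha>)"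
      using nu[of 1] that pos by simp
    also have "norm ((c 2)\<^sup>2) \<le> (\<bar>B\<bar> / (1 + \<alpha>))\<^sup>2"
      unfolding norm_power by (intro power_mono c2) simp
    finally show ?thesis
      by (simp add: power_divide)
  qed
  have small_\<nu>: "norm (c 3 - of_real \<nu> * (c 2)\<^sup>2) \<le> \<bar>B\<bar> / (2 + 4 * \<alpha>)"
    if "B \<noteq> 0" "\<bar>\<nu> - 1\<bar> \<le> \<bar>D\<bar> / (\<bar>B\<bar>\<^sup>2 * (2 + 4 * \<alpha>))" for \<nu>
  proof -
    \<comment> \<open>If \<open>D = 0\<close>, the threshold is 0 and forces
      \<open>\<nu> = 1\<close>.\<close>
    have nz: "D \<noteq> 0 \<or> \<nu> = 1"
      using that(2) by auto
    \<comment> \<open>For \<open>D = 0\<close> the left-hand side is 0 by the convention for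
      division by zero.\<close>
    have "\<bar>B\<bar> ^ 3 * \<bar>\<nu> - 1\<bar> / \<bar>D\<bar> \<le> \<bar>B\<bar> / (2 + 4 * \<alpha>)"
      using threshold_iff(1)[of "\<bar>B\<bar>" "2 + 4 * \<alpha>" "\<bar>D\<bar>"] that pos by (cases "D = 0") auto
    then show ?thesis
      using nu[OF that(1) nz] by (simp only: max_absorb2)
  qed
  have large_\<nu>: "norm (c 3 - of_real \<nu> * (c 2)\<^sup>2) \<le> \<bar>B\<bar> ^ 3 * \<bar>\<nu> - 1\<bar> / \<bar>D\<bar>"
    if "B \<noteq> 0" "D \<noteq> 0" "\<bar>\<nu> - 1\<bar> \<ge> \<bar>D\<bar> / (\<bar>B\<bar>\<^sup>2 * (2 + 4 * \<alpha>))" for \<nu>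
  proof -
    have "\<bar>B\<bar> / (2 + 4 * \<alpha>) \<le> \<bar>B\<bar> ^ 3 * \<bar>\<nu> - 1\<bar> / \<bar>D\<bar>"
      using threshold_iff(2)[of "\<bar>B\<bar>" "2 + 4 * \<alpha>" "\<bar>D\<bar>"] that pos by auto
    then show ?thesis
      using nu[OF that(1), of \<nu>] that(2) by (simp only: max_absorb1 simp_thms)
  qed
  show ?thesis
    unfolding bx2 B_def[symmetric]
    by (intro conjI allI impI; (elim conjE)?; rule a2_bound a3_bound small_\<nu> large_\<nu>; assumption)
qed

end
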